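(* Let $M$ be a compact connected complex manifold of complex dimension $n\ge 2$, let $\omega,\chi$ be Hermitian metrics on $M$, let $F\in C^\infty(M,\mathbb R)$, and let $0<T<\infty$. Let $\varphi$ and $\psi$ be two smooth admissible solutions on $M\times[0,T]$ of the flow $\partial_t\varphi=\mathcal Q_F(\varphi)$, with initial data $\varphi_0,\psi_0\in\mathcal H_\chi$ respectively. Then for every $t\in[0,T]$ $$\sup_M(\varphi(t)-\psi(t))\le\sup_M(\varphi(0)-\psi(0)),\qquad \inf_M(\varphi(t)-\psi(t))\ge\inf_M(\varphi(0)-\psi(0)),$$ and consequently $$\operatorname{osc}_M(\varphi(t)-\psi(t))\le\operatorname{osc}_M(\varphi(0)-\psi(0)).$$
   Context: Hermitian metrics are identified with their positive real $(1,1)$-forms; no closedness is assumed. $\mathcal H_\chi=\{\varphi\in C^\infty(M,\mathbb R):\chi_\varphi:=\chi+\sqrt{-1}\,\partial\bar\partial\varphi>0\}$. For $\varphi\in\mathcal H_\chi$, $$\mathcal Q_F(\varphi)=\log\frac{\chi_\varphi^n}{\omega\wedge\chi_\varphi^{n-1}}+F=\log n-\log\operatorname{tr}_{\chi_\varphi}\omega+F.$$ A solution is admissible if $\varphi(\cdot,t)\in\mathcal H_\chi$ for every $t$. $\operatorname{osc}_Mf=\sup_Mf-\inf_Mf$. *)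

theory Defs
  imports "HOL-Analysis.Analysis"
begin

section \<open>Smooth and holomorphic maps between Euclidean spaces\<close>

(* Derivatives are taken within S, so that the notion also makes sense up to the boundary of
   S = V \<times> {0..T} with V open and 0 < T.  On such sets, and on open sets, the derivative within S
   is unique. *)
fun Ck_on :: "nat \<Rightarrow> ('a::euclidean_space \<Rightarrow> 'b::real_normed_vector) \<Rightarrow> 'a set \<Rightarrow> bool" where
  "Ck_on 0 f S \<longleftrightarrow> continuous_on S f"
| "Ck_on (Suc k) f S \<longleftrightarrow> f differentiable_on S \<and>
     (\<forall>v. Ck_on k (\<lambda>x. frechet_derivative f (at x within S) v) S)"

definition smooth_on :: "('a::euclidean_space \<Rightarrow> 'b::real_normed_vector) \<Rightarrow> 'a set \<Rightarrow> bool" where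
  "smooth_on f S \<longleftrightarrow> (\<forall>k. Ck_on k f S)"

definition holomorphic_map_on :: "(complex^'n \<Rightarrow> complex^'m) \<Rightarrow> (complex^'n) set \<Rightarrow> bool" where
  "holomorphic_map_on f S \<longleftrightarrow>
     (\<forall>z\<in>S. \<exists>L. (f has_derivative L) (at z) \<and> (\<forall>a v. L (a *s v) = a *s L v))"

(* With z_i = x_i + \<i> y_i:  d/dz_i = (d/dx_i - \<i> d/dy_i)/2  and  d/dzbar_i = (d/dx_i + \<i> d/dy_i)/2. *)
definition d_z :: "'n \<Rightarrow> (complex^'n \<Rightarrow> complex) \<Rightarrow> complex^'n \<Rightarrow> complex" where
  "d_z i f z = (frechet_derivative f (at z) (axis i 1)
                - \<i> * frechet_derivative f (at z) (axis i \<i>)) / 2"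

definition d_zbar :: "'n \<Rightarrow> (complex^'n \<Rightarrow> complex) \<Rightarrow> complex^'n \<Rightarrow> complex" where
  "d_zbar i f z = (frechet_derivative f (at z) (axis i 1)
                   + \<i> * frechet_derivative f (at z) (axis i \<i>)) / 2"

section \<open>Complex manifolds\<close>

(* The manifold is the whole type 'a.  A chart is a coordinate domain together with its coordinate
   map; the values of the map outside the domain are irrelevant. *)
type_synonym ('a, 'n) chart = "'a set \<times> ('a \<Rightarrow> complex^'n)"

definition cdom :: "('a, 'n::finite) chart \<Rightarrow> 'a set" where
  "cdom c = fst c"

definition cmap :: "('a, 'n::finite) chart \<Rightarrow> 'a \<Rightarrow> complex^'n" where
  "cmap c = snd c"

definition cimg :: "('a, 'n::finite) chart \<Rightarrow> (complex^'n) set" where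
  "cimg c = cmap c ` cdom c"

definition cinv :: "('a, 'n::finite) chart \<Rightarrow> complex^'n \<Rightarrow> 'a" where
  "cinv c = inv_into (cdom c) (cmap c)"

(* Together with the class t2_space this is a complex manifold of dimension CARD('n).  Second
   countability is not listed: it follows once the space is compact. *)
definition complex_atlas :: "('a::t2_space, 'n::finite) chart set \<Rightarrow> bool" where
  "complex_atlas A \<longleftrightarrow>
     (\<Union>c\<in>A. cdom c) = UNIV \<and>
     (\<forall>c\<in>A. open (cdom c) \<and> open (cimg c) \<and>
             homeomorphism (cdom c) (cimg c) (cmap c) (cinv c)) \<and>
     (\<forall>c\<in>A. \<forall>d\<in>A. holomorphic_map_on (cmap d \<circ> cinv c) (cmap c ` (cdom c \<inter> cdom d)))"

definition smooth_fun :: "('a::t2_space, 'n::finite) chart set \<Rightarrow> ('a \<Rightarrow> real) \<Rightarrow> bool" where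
  "smooth_fun A f \<longleftrightarrow> (\<forall>c\<in>A. smooth_on (f \<circ> cinv c) (cimg c))"

definition smooth_fun_time ::
    "('a::t2_space, 'n::finite) chart set \<Rightarrow> real \<Rightarrow> (real \<Rightarrow> 'a \<Rightarrow> real) \<Rightarrow> bool" where
  "smooth_fun_time A T u \<longleftrightarrow>
     (\<forall>c\<in>A. smooth_on (\<lambda>(z, t). u t (cinv c z)) (cimg c \<times> {0..T}))"

section \<open>Real (1,1)-forms and Hermitian metrics\<close>

(* A (1,1)-form \<alpha> is given by its coefficients in every chart:  \<alpha> c p $ i $ j  is the coefficient
   \<alpha>_{i jbar}(p) in  \<alpha> = \<i> \<Sum> \<alpha>_{i jbar} dz_i \<and> dzbar_j,  z the coordinates of the chart c. *)
type_synonym ('a, 'n) form11 = "('a, 'n) chart \<Rightarrow> 'a \<Rightarrow> complex^'n^'n"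

definition positive_hermitian :: "complex^'n^'n \<Rightarrow> bool" where
  "positive_hermitian G \<longleftrightarrow>
     (\<forall>i j. G $ j $ i = cnj (G $ i $ j)) \<and>
     (\<forall>v. v \<noteq> 0 \<longrightarrow> 0 < Re (\<Sum>i\<in>UNIV. \<Sum>j\<in>UNIV. G $ i $ j * v $ i * cnj (v $ j)))"

definition positive_form :: "('a, 'n::finite) chart set \<Rightarrow> ('a, 'n) form11 \<Rightarrow> bool" where
  "positive_form A \<alpha> \<longleftrightarrow> (\<forall>c\<in>A. \<forall>p\<in>cdom c. positive_hermitian (\<alpha> c p))"

(* The last condition is the transformation law under the coordinate change from the coordinates z
   of c to the coordinates w of d, with d_z i (\<dots>) the entries dw_k/dz_i of its Jacobian. *)
definition smooth_form11 :: "('a::t2_space, 'n::finite) chart set \<Rightarrow> ('a, 'n) form11 \<Rightarrow> bool" where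
  "smooth_form11 A \<alpha> \<longleftrightarrow>
     (\<forall>c\<in>A. \<forall>i j. smooth_on (\<lambda>z. \<alpha> c (cinv c z) $ i $ j) (cimg c)) \<and>
     (\<forall>c\<in>A. \<forall>d\<in>A. \<forall>p\<in>cdom c \<inter> cdom d. \<forall>i j.
        \<alpha> c p $ i $ j =
          (\<Sum>k\<in>UNIV. \<Sum>l\<in>UNIV. \<alpha> d p $ k $ l
             * d_z i (\<lambda>z. cmap d (cinv c z) $ k) (cmap c p)
             * cnj (d_z j (\<lambda>z. cmap d (cinv c z) $ l) (cmap c p))))"

definition hermitian_metric :: "('a::t2_space, 'n::finite) chart set \<Rightarrow> ('a, 'n) form11 \<Rightarrow> bool" where
  "hermitian_metric A \<alpha> \<longleftrightarrow> smooth_form11 A \<alpha> \<and> positive_form A \<alpha>"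

definition ddbar :: "('a \<Rightarrow> real) \<Rightarrow> ('a, 'n::finite) form11" where
  "ddbar \<phi> c p =
     (\<chi> i j. d_z i (d_zbar j (\<lambda>z. complex_of_real (\<phi> (cinv c z)))) (cmap c p))"

definition deformed_form :: "('a, 'n::finite) form11 \<Rightarrow> ('a \<Rightarrow> real) \<Rightarrow> ('a, 'n) form11" where
  "deformed_form X \<phi> c p = X c p + ddbar \<phi> c p"

definition admissible_potentials ::
    "('a::t2_space, 'n::finite) chart set \<Rightarrow> ('a, 'n) form11 \<Rightarrow> ('a \<Rightarrow> real) set" where
  "admissible_potentials A X = {\<phi>. smooth_fun A \<phi> \<and> positive_form A (deformed_form X \<phi>)}"

section \<open>The flow\<close>

(* tr_\<beta> \<alpha> = \<beta>^{i jbar} \<alpha>_{i jbar}, the trace of \<beta>^{-1} \<alpha>.  By the transformation law its value at p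
   does not depend on the chart around p, so an arbitrary one is chosen. *)
definition form_trace ::
    "('a, 'n::finite) chart set \<Rightarrow> ('a, 'n) form11 \<Rightarrow> ('a, 'n) form11 \<Rightarrow> 'a \<Rightarrow> real" where
  "form_trace A \<beta> \<alpha> p =
     (let c = (SOME c. c \<in> A \<and> p \<in> cdom c) in Re (trace (matrix_inv (\<beta> c p) ** \<alpha> c p)))"

(* With \<chi>' = deformed_form X \<phi>, this is  log (\<chi>'^n / (\<omega> \<and> \<chi>'^(n-1))) + F,  because
   n \<omega> \<and> \<chi>'^(n-1) = (tr_{\<chi>'} \<omega>) \<chi>'^n. *)
definition Q_op ::
    "('a, 'n::finite) chart set \<Rightarrow> ('a, 'n) form11 \<Rightarrow> ('a, 'n) form11 \<Rightarrow> ('a \<Rightarrow> real)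
      \<Rightarrow> ('a \<Rightarrow> real) \<Rightarrow> 'a \<Rightarrow> real" where
  "Q_op A X \<omega> F \<phi> p =
     ln (real CARD('n)) - ln (form_trace A (deformed_form X \<phi>) \<omega> p) + F p"

definition admissible_solution ::
    "('a::t2_space, 'n::finite) chart set \<Rightarrow> ('a, 'n) form11 \<Rightarrow> ('a, 'n) form11 \<Rightarrow> ('a \<Rightarrow> real)
      \<Rightarrow> real \<Rightarrow> (real \<Rightarrow> 'a \<Rightarrow> real) \<Rightarrow> bool" where
  "admissible_solution A X \<omega> F T \<phi> \<longleftrightarrow>
     smooth_fun_time A T \<phi> \<and>
     (\<forall>t\<in>{0..T}. \<phi> t \<in> admissible_potentials A X) \<and>
     (\<forall>t\<in>{0..T}. \<forall>p.
        ((\<lambda>s. \<phi> s p) has_real_derivative Q_op A X \<omega> F (\<phi> t) p) (at t within {0..T}))"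

definition osc :: "('a \<Rightarrow> real) \<Rightarrow> real" where
  "osc f = (SUP p. f p) - (INF p. f p)"

end

theory Submission
  imports Defs
begin

text \<open>
  The parabolic maximum principle, applied to the nonlinear operator itself, so that no linearisation
  is needed.  If \<open>\<phi> - \<psi> - d * t\<close> with \<open>d > 0\<close> had its maximum over space-time at a
  point with \<open>t > 0\<close>, the complex Hessian of \<open>\<phi> - \<psi>\<close> would be negative semidefinite
  there, so \<open>\<chi>\<^sub>\<phi> \<le> \<chi>\<^sub>\<psi>\<close>.  Since inversion reverses the order of positive
  Hermitian matrices, the trace of \<open>\<omega>\<close> with respect to \<open>\<chi>\<^sub>\<phi>\<close> is the larger one and
  the time derivative of \<open>\<phi> - \<psi> - d * t\<close> is at most \<open>-d < 0\<close>, which is impossible at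
  such a maximum.
\<close>

section \<open>Sesquilinear forms and rank-one decompositions\<close>

text \<open>The unconjugated vector pairs with the first index, as in
  \<open>positive_hermitian\<close>. Hence row products \<open>v v* G\<close>, not column products,
  appear below.\<close>

definition sesq :: "complex^'n^'n \<Rightarrow> complex^'n \<Rightarrow> complex^'n \<Rightarrow> complex" where
  "sesq G v w = (\<Sum>i\<in>UNIV. \<Sum>j\<in>UNIV. G $ i $ j * v $ i * cnj (w $ j))"

lemma sesq_diff_left: "sesq G (u - v) w = sesq G u w - sesq G v w"
  by (simp add: sesq_def algebra_simps sum_subtractf)

lemma sesq_diff_right: "sesq G u (v - w) = sesq G u v - sesq G u w"
  by (simp add: sesq_def algebra_simps sum_subtractf)

lemma sesq_scale_left: "sesq G (c *s v) w = c * sesq G v w"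
  by (simp add: sesq_def sum_distrib_left mult_ac)

lemma sesq_scale_right: "sesq G v (c *s w) = cnj c * sesq G v w"
  by (simp add: sesq_def sum_distrib_left mult_ac)

lemma sesq_axis_left: "sesq G (axis k 1) w = (\<Sum>j\<in>UNIV. G $ k $ j * cnj (w $ j))"
  unfolding sesq_def
  by (subst sum.swap) (simp add: axis_def if_distrib[of "\<lambda>x. _ * x"] if_distrib[of "\<lambda>x. x * _"] cong: if_cong)

lemma sesq_axis_right: "sesq G v (axis k 1) = (\<Sum>i\<in>UNIV. G $ i $ k * v $ i)"
  by (simp add: sesq_def axis_def if_distrib[of cnj] if_distrib[of "\<lambda>x. _ * x"] cong: if_cong)

lemma sesq_axis_axis: "sesq G (axis k 1) (axis k 1) = G $ k $ k"
  by (simp add: sesq_axis_right) (simp add: axis_def if_distrib[of "\<lambda>x. _ * x"] cong: if_cong)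

lemma sesq_commute:
  assumes "\<And>i j. G $ j $ i = cnj (G $ i $ j)"
  shows "sesq G w v = cnj (sesq G v w)"
proof -
  have "cnj (sesq G v w) = (\<Sum>i\<in>UNIV. \<Sum>j\<in>UNIV. G $ j $ i * w $ j * cnj (v $ i))"
    unfolding sesq_def cnj_sum
    by (intro sum.cong refl) (simp add: assms[symmetric] mult_ac)
  also have "\<dots> = sesq G w v"
    unfolding sesq_def by (rule sum.swap)
  finally show ?thesis by simp
qed

text \<open>Cholesky decomposition: each step splits off a rank-one matrix, and completing the square shows
  that the Schur complement \<open>C\<close> stays positive on the remaining indices.\<close>

lemma positive_hermitian_on_decomposition:
  fixes B :: "complex^'n^'n"
  assumes "finite S"
    and "\<And>i j. B $ j $ i = cnj (B $ i $ j)"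
    and "\<And>i j. i \<notin> S \<Longrightarrow> B $ i $ j = 0"
    and "\<And>v. v \<noteq> 0 \<Longrightarrow> (\<forall>i. i \<notin> S \<longrightarrow> v $ i = 0) \<Longrightarrow> 0 < Re (sesq B v v)"
  shows "\<exists>x::'n \<Rightarrow> complex^'n. \<forall>i j. B $ i $ j = (\<Sum>k\<in>S. cnj (x k $ i) * x k $ j)"
  using assms
proof (induction S arbitrary: B rule: finite_induct)
  case empty
  then show ?case by simp
next
  case (insert k S)
  note herm = insert.prems(1) and supp = insert.prems(2) and pos = insert.prems(3)
  define b where "b = Re (B $ k $ k)"
  have bk: "B $ k $ k = of_real b"
    using herm[of k k] by (simp add: b_def complex_eq_iff)
  have b: "b > 0"
  proof -
    have "0 < Re (sesq B (axis k 1) (axis k 1))"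
      by (rule pos) (auto simp: axis_def vec_eq_iff)
    then show ?thesis
      by (simp add: sesq_axis_axis bk)
  qed
  define C where "C = (\<chi> i j. B $ i $ j - B $ i $ k * B $ k $ j / of_real b)"
  have C_herm: "C $ j $ i = cnj (C $ i $ j)" for i j
    by (simp add: C_def herm[symmetric] mult.commute)
  have C_supp: "C $ i $ j = 0" if "i \<notin> S" for i j
    using that supp[of i] b by (cases "i = k") (auto simp: C_def bk)
  have C_pos: "0 < Re (sesq C v v)" if v: "v \<noteq> 0" "\<forall>i. i \<notin> S \<longrightarrow> v $ i = 0" for v
  proof -
    define L where "L = sesq B v (axis k 1)"
    \<comment> \<open>\<open>y\<close> is \<open>v\<close> minus its \<open>B\<close>-orthogonal
      projection onto the \<open>k\<close>-th basis vector, so the value of \<open>B\<close> at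
      \<open>y\<close> is the completed square.\<close>
    define y where "y = v - (L / of_real b) *s axis k 1"
    have L': "sesq B (axis k 1) v = cnj L"
      unfolding L_def by (rule sesq_commute) (rule herm)
    have Bkk: "sesq B (axis k 1) (axis k 1) = of_real b"
      by (simp add: sesq_axis_axis bk)
    have "y \<noteq> 0"
    proof
      assume "y = 0"
      then have *: "v = (L / of_real b) *s axis k 1"
        by (simp add: y_def)
      have "v $ k = 0" using v(2) insert.hyps by auto
      with * have "L / of_real b = 0" by (metis mult.right_neutral axis_nth vector_smult_component)
      with * v(1) show False by simp
    qed
    moreover have "\<forall>i. i \<notin> insert k S \<longrightarrow> y $ i = 0"
      using v(2) by (auto simp: y_def axis_def)
    ultimately have "0 < Re (sesq B y y)" by (rule pos)
    also have "sesq B y y = sesq B v v - L * cnj L / of_real b"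
      using b by (simp add: y_def sesq_diff_left sesq_diff_right sesq_scale_left sesq_scale_right
          L' Bkk flip: L_def)
    also have "\<dots> = sesq C v v"
    proof -
      have "L * cnj L = (\<Sum>i\<in>UNIV. B $ i $ k * v $ i) * (\<Sum>j\<in>UNIV. B $ k $ j * cnj (v $ j))"
        by (simp only: L'[symmetric] sesq_axis_left) (simp only: L_def sesq_axis_right)
      then have "sesq B v v - L * cnj L / of_real b = (\<Sum>i\<in>UNIV. \<Sum>j\<in>UNIV.
          B $ i $ j * v $ i * cnj (v $ j) - B $ i $ k * v $ i * (B $ k $ j * cnj (v $ j)) / of_real b)"
        by (simp only: sesq_def sum_product sum_divide_distrib sum_subtractf)
      also have "\<dots> = sesq C v v"
        unfolding sesq_def by (intro sum.cong refl) (simp add: C_def algebra_simps)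
      finally show ?thesis .
    qed
    finally show ?thesis .
  qed
  obtain x :: "'n \<Rightarrow> complex^'n"
    where x: "\<And>i j. C $ i $ j = (\<Sum>k\<in>S. cnj (x k $ i) * x k $ j)"
    using insert.IH[OF C_herm C_supp C_pos] by blast
  \<comment> \<open>The new vector is row \<open>k\<close> of \<open>B\<close> over the square root
    of the pivot; its rank-one matrix is exactly what was subtracted to form
    \<open>C\<close>.\<close>
  define x' where "x' = x(k := (\<chi> j. B $ k $ j / of_real (sqrt b)))"
  have "B $ i $ j = (\<Sum>l\<in>insert k S. cnj (x' l $ i) * x' l $ j)" for i j
  proof -
    have "(\<Sum>l\<in>S. cnj (x' l $ i) * x' l $ j) = C $ i $ j"
      unfolding x using insert.hyps by (intro sum.cong) (auto simp: x'_def)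
    moreover have "cnj (x' k $ i) * x' k $ j = B $ i $ k * B $ k $ j / of_real b"
    proof -
      have "complex_of_real (sqrt b) * of_real (sqrt b) = of_real b"
        using b by (simp flip: of_real_mult)
      then show ?thesis
        using herm[of k i] by (simp add: x'_def)
    qed
    ultimately show ?thesis
      using insert.hyps by (simp add: C_def)
  qed
  then show ?case by blast
qed

lemma positive_hermitian_cnj: "positive_hermitian G \<Longrightarrow> G $ j $ i = cnj (G $ i $ j)"
  unfolding positive_hermitian_def by blast

lemma positive_hermitian_sesq_pos: "positive_hermitian G \<Longrightarrow> v \<noteq> 0 \<Longrightarrow> 0 < Re (sesq G v v)"
  unfolding positive_hermitian_def sesq_def by blast

lemma positive_hermitian_sesq_nonneg: "positive_hermitian G \<Longrightarrow> 0 \<le> Re (sesq G v v)"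
  using positive_hermitian_sesq_pos[of G v] by (cases "v = 0") (auto simp: sesq_def)

lemma positive_hermitian_decomposition:
  assumes "positive_hermitian (W :: complex^'n^'n)"
  shows "\<exists>x::'n \<Rightarrow> complex^'n. \<forall>i j. W $ i $ j = (\<Sum>k\<in>UNIV. cnj (x k $ i) * x k $ j)"
  by (rule positive_hermitian_on_decomposition)
    (use assms in \<open>blast intro: finite positive_hermitian_cnj positive_hermitian_sesq_pos\<close>)+

text \<open>Writing \<open>W\<close> as a sum of rank-one matrices turns a trace against
  \<open>W\<close> into a sum of values of the form \<open>M\<close>, so inequalities between forms
  pass to traces.\<close>

lemma trace_mult_decomposition:
  fixes M W :: "complex^'n^'n" and x :: "'n \<Rightarrow> complex^'n"
  assumes "\<And>i j. W $ i $ j = (\<Sum>k\<in>UNIV. cnj (x k $ i) * x k $ j)"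
  shows "trace (M ** W) = (\<Sum>k\<in>UNIV. sesq M (x k) (x k))"
proof -
  have "trace (M ** W) =
      (\<Sum>i\<in>UNIV. \<Sum>j\<in>UNIV. \<Sum>k\<in>UNIV. M $ i $ j * x k $ i * cnj (x k $ j))"
    by (simp add: trace_def matrix_matrix_mult_def assms sum_distrib_left mult_ac)
  also have "\<dots> = (\<Sum>i\<in>UNIV. \<Sum>k\<in>UNIV. \<Sum>j\<in>UNIV. M $ i $ j * x k $ i * cnj (x k $ j))"
    by (intro sum.cong refl sum.swap)
  also have "\<dots> = (\<Sum>k\<in>UNIV. sesq M (x k) (x k))"
    unfolding sesq_def by (rule sum.swap)
  finally show ?thesis .
qed

section \<open>Inverses of positive Hermitian matrices and their traces\<close>

lemma positive_hermitian_invertible: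
  assumes "positive_hermitian G"
  shows "invertible G"
proof -
  have "z = 0" if "G *v z = 0" for z
  proof (rule ccontr)
    assume "z \<noteq> 0"
    \<comment> \<open>The kernel vector is conjugated because \<open>*v\<close> sums over the second
      index, which \<open>sesq\<close> pairs with a conjugate.\<close>
    let ?v = "\<chi> i. cnj (z $ i)"
    have "?v \<noteq> 0" using \<open>z \<noteq> 0\<close> by (auto simp: vec_eq_iff)
    then have "0 < Re (sesq G ?v ?v)" using assms by (intro positive_hermitian_sesq_pos)
    also have "sesq G ?v ?v = (\<Sum>i\<in>UNIV. cnj (z $ i) * (G *v z) $ i)"
      by (simp add: sesq_def matrix_vector_mult_def sum_distrib_left mult_ac)
    finally show False by (simp add: that)
  qed
  then show ?thesis
    by (simp add: invertible_left_inverse matrix_left_invertible_ker)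
qed

lemma sesq_eq_vector_matrix_mult:
  "sesq G v w = (\<Sum>j\<in>UNIV. (v v* G) $ j * cnj (w $ j))"
  unfolding sesq_def
  by (subst sum.swap) (simp add: vector_matrix_mult_def sum_distrib_left mult_ac)

lemma matrix_inv_mult_left:
  assumes "invertible G"
  shows "matrix_inv G ** G = mat 1"
  using someI_ex[OF assms[unfolded invertible_def]] by (simp add: matrix_inv_def)

text \<open>\<open>x v* matrix_inv G\<close> is the vector that represents the standard pairing with
  \<open>x\<close> through \<open>G\<close>. The right side is free of \<open>G\<close>, which lets
  two matrices be compared.\<close>

lemma sesq_matrix_inv:
  assumes "invertible G"
  shows "sesq G (x v* matrix_inv G) y = (\<Sum>j\<in>UNIV. x $ j * cnj (y $ j))"
proof -
  have "sesq G (x v* matrix_inv G) y = (\<Sum>j\<in>UNIV. ((x v* matrix_inv G) v* G) $ j * cnj (y $ j))"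
    by (rule sesq_eq_vector_matrix_mult)
  also have "(x v* matrix_inv G) v* G = x"
    using assms by (simp add: vector_matrix_mul_assoc matrix_inv_mult_left)
  finally show ?thesis .
qed

text \<open>Both values are the standard pairing of \<open>x\<close> with
  \<open>x v* matrix_inv G\<close>, in opposite orders; they differ by a conjugation, which the real
  part removes.\<close>

lemma Re_sesq_of_matrix_inv:
  assumes "positive_hermitian G"
  shows "Re (sesq (matrix_inv G) x x) = Re (sesq G (x v* matrix_inv G) (x v* matrix_inv G))"
proof -
  have "sesq (matrix_inv G) x x = cnj (sesq G (x v* matrix_inv G) (x v* matrix_inv G))"
    by (simp add: sesq_eq_vector_matrix_mult[of "matrix_inv G"]
        sesq_matrix_inv[OF positive_hermitian_invertible[OF assms]] mult.commute)
  then show ?thesis by simp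
qed

lemma sesq_matrix_inv_pos:
  assumes "positive_hermitian G" and "x \<noteq> 0"
  shows "0 < Re (sesq (matrix_inv G) x x)"
proof -
  have "(x v* matrix_inv G) v* G = x"
    using positive_hermitian_invertible[OF assms(1)]
    by (simp add: vector_matrix_mul_assoc matrix_inv_mult_left)
  then have "x v* matrix_inv G \<noteq> 0" using assms(2) by force
  then show ?thesis
    using assms(1) by (simp add: Re_sesq_of_matrix_inv positive_hermitian_sesq_pos)
qed

text \<open>With \<open>z\<close> and \<open>y\<close> representing the same \<open>x\<close>
  through \<open>G\<close> and \<open>H\<close>, the cross term \<open>sesq G z y\<close> equals
  \<open>sesq H y y\<close>; nonnegativity of \<open>G\<close> at \<open>z - y\<close> then gives
  the bound.\<close>

lemma sesq_matrix_inv_antimono: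
  assumes G: "positive_hermitian G" and H: "positive_hermitian H"
    and le: "\<And>v. Re (sesq G v v) \<le> Re (sesq H v v)"
  shows "Re (sesq (matrix_inv H) x x) \<le> Re (sesq (matrix_inv G) x x)"
proof -
  define z y where "z = x v* matrix_inv G" and "y = x v* matrix_inv H"
  \<comment> \<open>expanding this square gives \<open>2 H(y,y) - G(y,y) \<le> G(z,z)\<close>\<close>
  have nonneg: "0 \<le> Re (sesq G (z - y) (z - y))"
    using G by (rule positive_hermitian_sesq_nonneg)
  have zy: "sesq G z y = sesq H y y"
    unfolding y_def z_def using G H by (simp add: sesq_matrix_inv positive_hermitian_invertible)
  moreover have "sesq G y z = cnj (sesq G z y)"
    using G by (intro sesq_commute positive_hermitian_cnj)
  ultimately have "Re (sesq G (z - y) (z - y)) =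
      Re (sesq G z z) - 2 * Re (sesq H y y) + Re (sesq G y y)"
    by (simp add: sesq_diff_left sesq_diff_right)
  then have "Re (sesq H y y) \<le> Re (sesq G z z)"
    using nonneg le[of y] by simp
  then show ?thesis
    using G H by (simp add: Re_sesq_of_matrix_inv y_def z_def)
qed

lemma trace_matrix_inv_pos:
  fixes G W :: "complex^'n^'n"
  assumes "positive_hermitian G" and W: "positive_hermitian W"
  shows "0 < Re (trace (matrix_inv G ** W))"
proof -
  obtain x :: "'n \<Rightarrow> complex^'n"
    where x: "\<And>i j. W $ i $ j = (\<Sum>k\<in>UNIV. cnj (x k $ i) * x k $ j)"
    using positive_hermitian_decomposition[OF W] by blast
  have "\<exists>k. x k \<noteq> 0"
  proof (rule ccontr)
    assume "\<not> ?thesis"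
    \<comment> \<open>If all vectors vanish then so does \<open>W\<close>, against its positivity on
      a basis vector; \<open>undefined\<close> just names some index.\<close>
    then have "sesq W (axis undefined 1) (axis undefined 1) = 0"
      by (simp add: sesq_def x)
    moreover have "axis undefined 1 \<noteq> (0 :: complex^'n)"
      by (auto simp: axis_def vec_eq_iff)
    ultimately show False
      using positive_hermitian_sesq_pos[OF W] by (metis less_irrefl zero_complex.simps(1))
  qed
  then obtain k where k: "x k \<noteq> 0" ..
  have "0 < (\<Sum>k\<in>UNIV. Re (sesq (matrix_inv G) (x k) (x k)))"
  proof (rule sum_pos2[of _ k])
    show "0 \<le> Re (sesq (matrix_inv G) (x l) (x l))" for l
      using sesq_matrix_inv_pos[OF assms(1), of "x l"]
      by (cases "x l = 0") (auto simp: sesq_def)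
  qed (auto simp: sesq_matrix_inv_pos assms(1) k)
  then show ?thesis
    by (simp add: trace_mult_decomposition[OF x])
qed

lemma trace_matrix_inv_antimono:
  fixes G H W :: "complex^'n^'n"
  assumes "positive_hermitian G" and "positive_hermitian H"
    and W: "positive_hermitian W"
    and "\<And>v. Re (sesq G v v) \<le> Re (sesq H v v)"
  shows "Re (trace (matrix_inv H ** W)) \<le> Re (trace (matrix_inv G ** W))"
proof -
  obtain x :: "'n \<Rightarrow> complex^'n"
    where x: "\<And>i j. W $ i $ j = (\<Sum>k\<in>UNIV. cnj (x k $ i) * x k $ j)"
    using positive_hermitian_decomposition[OF W] by blast
  show ?thesis
    by (simp add: trace_mult_decomposition[OF x]) (intro sum_mono sesq_matrix_inv_antimono assms)
qed

section \<open>Second derivatives at a maximum and the complex Hessian\<close>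

text \<open>If \<open>D > 0\<close>, then \<open>h'\<close> vanishes at 0 and is positive just to
  the right, so the mean value theorem makes \<open>h\<close> exceed \<open>h 0\<close>
  there.\<close>

lemma second_derivative_nonpos_at_max:
  fixes h h' :: "real \<Rightarrow> real"
  assumes "0 < e" and max: "\<And>s. \<bar>s\<bar> < e \<Longrightarrow> h s \<le> h 0"
    and h': "\<And>s. \<bar>s\<bar> < e \<Longrightarrow> (h has_real_derivative h' s) (at s)"
    and h'': "(h' has_real_derivative D) (at 0)"
  shows "D \<le> 0"
proof (rule ccontr)
  assume "\<not> D \<le> 0"
  have "h' 0 = 0"
    using DERIV_local_max[OF h'[of 0] \<open>0 < e\<close>] max \<open>0 < e\<close> by simp
  obtain d where d: "d > 0" "\<And>s. 0 < s \<Longrightarrow> s < d \<Longrightarrow> h' 0 < h' (0 + s)"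
    using DERIV_pos_inc_right[OF h''] \<open>\<not> D \<le> 0\<close> by auto
  define s where "s = min d e / 2"
  have s: "0 < s" "s < d" "s < e" using d(1) \<open>0 < e\<close> by (auto simp: s_def)
  obtain r where r: "0 < r" "r < s" "h s - h 0 = (s - 0) * h' r"
    using MVT2[of 0 s h h'] h' s by auto
  have "0 < h' r" using d(2)[of r] r s \<open>h' 0 = 0\<close> by simp
  then have "h 0 < h s" using r s(1) by (simp add: algebra_simps)
  then show False using max[of s] s by simp
qed

text \<open>An iterated directional derivative, first along \<open>b\<close>, then along
  \<open>a\<close>.\<close>

definition hess :: "('a::real_normed_vector \<Rightarrow> real) \<Rightarrow> 'a \<Rightarrow> 'a \<Rightarrow> 'a \<Rightarrow> real" where
  "hess f z a b = frechet_derivative (\<lambda>w. frechet_derivative f (at w) b) (at z) a"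

text \<open>\<open>smooth_on\<close> differentiates within the set, whereas \<open>d_z\<close> and
  \<open>d_zbar\<close> differentiate at the point; on an open set the two agree.\<close>

lemma smooth_on_derivatives:
  assumes "smooth_on f U" and "open U" and "z \<in> U"
  shows "f differentiable at z"
    and "(\<lambda>w. frechet_derivative f (at w) b) differentiable at z"
proof -
  have "Ck_on (Suc (Suc 0)) f U" using assms(1) by (simp add: smooth_on_def)
  then have 1: "f differentiable_on U"
    and 2: "(\<lambda>w. frechet_derivative f (at w within U) b) differentiable_on U"
    by auto
  show "f differentiable at z"
    using 1 assms(2,3) by (simp add: differentiable_on_eq_differentiable_at)
  have "(\<lambda>w. frechet_derivative f (at w within U) b) differentiable at z"
    using 2 assms(2,3) by (simp add: differentiable_on_eq_differentiable_at)
  then obtain D where "((\<lambda>w. frechet_derivative f (at w within U) b) has_derivative D) (at z)"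
    by (auto simp: differentiable_def)
  then have "((\<lambda>w. frechet_derivative f (at w) b) has_derivative D) (at z)"
    by (rule has_derivative_transform_within_open[OF _ assms(2,3)])
      (simp add: at_within_open[OF _ assms(2)])
  then show "(\<lambda>w. frechet_derivative f (at w) b) differentiable at z"
    by (auto simp: differentiable_def)
qed

lemma has_derivative_hess:
  assumes "smooth_on f U" and "open U" and "z \<in> U"
  shows "((\<lambda>w. frechet_derivative f (at w) b) has_derivative (\<lambda>a. hess f z a b)) (at z)"
  using smooth_on_derivatives(2)[OF assms] by (simp add: hess_def frechet_derivative_works)

lemma linear_hess_left:
  assumes "smooth_on f U" and "open U" and "z \<in> U"
  shows "linear (\<lambda>a. hess f z a b)"
  using has_derivative_hess[OF assms] by (rule has_derivative_linear)

text \<open>The first derivative is linear in its direction at every point of \<open>U\<close>;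
  differentiating that identity and using uniqueness of derivatives gives linearity in the inner
  direction.\<close>

lemma linear_hess_right:
  assumes f: "smooth_on f U" "open U" "z \<in> U"
  shows "linear (hess f z a)"
proof (rule linearI)
  have lin: "linear (frechet_derivative f (at w))" if "w \<in> U" for w
    using smooth_on_derivatives(1)[OF f(1,2) that] by (rule linear_frechet_derivative)
  fix b c r
  have "((\<lambda>w. frechet_derivative f (at w) (b + c)) has_derivative (\<lambda>a. hess f z a b + hess f z a c)) (at z)"
    by (rule has_derivative_transform_within_open[OF
          has_derivative_add[OF has_derivative_hess[OF f] has_derivative_hess[OF f]] f(2,3)])
      (simp add: lin linear_add)
  from has_derivative_unique[OF has_derivative_hess[OF f] this]
  show "hess f z a (b + c) = hess f z a b + hess f z a c" by metis
  have "((\<lambda>w. frechet_derivative f (at w) (r *\<^sub>R b)) has_derivative (\<lambda>a. r *\<^sub>R hess f z a b)) (at z)"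
    by (rule has_derivative_transform_within_open[OF
          has_derivative_scaleR_right[OF has_derivative_hess[OF f]] f(2,3)])
      (simp add: lin linear_scale)
  from has_derivative_unique[OF has_derivative_hess[OF f] this]
  show "hess f z a (r *\<^sub>R b) = r *\<^sub>R hess f z a b" by metis
qed

lemma d_z_d_zbar_hess:
  fixes f :: "complex^'n \<Rightarrow> real"
  assumes f: "smooth_on f U" "open U" "z \<in> U"
  shows "d_z i (d_zbar j (\<lambda>w. complex_of_real (f w))) z =
    (of_real (hess f z (axis i 1) (axis j 1) + hess f z (axis i \<i>) (axis j \<i>))
     + \<i> * of_real (hess f z (axis i 1) (axis j \<i>) - hess f z (axis i \<i>) (axis j 1))) / 4"
proof -
  \<comment> \<open>The formula is needed on all of \<open>U\<close>, not only at \<open>z\<close>,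
    because it is differentiated once more.\<close>
  have inner: "d_zbar j (\<lambda>w. complex_of_real (f w)) w =
      (of_real (frechet_derivative f (at w) (axis j 1))
       + \<i> * of_real (frechet_derivative f (at w) (axis j \<i>))) / 2" if "w \<in> U" for w
  proof -
    have "(f has_derivative frechet_derivative f (at w)) (at w)"
      using smooth_on_derivatives(1)[OF f(1,2) that] by (simp add: frechet_derivative_works)
    then have "((\<lambda>w. complex_of_real (f w)) has_derivative
        (\<lambda>v. of_real (frechet_derivative f (at w) v))) (at w)"
      by (rule has_derivative_of_real)
    then have "frechet_derivative (\<lambda>w. complex_of_real (f w)) (at w) =
        (\<lambda>v. of_real (frechet_derivative f (at w) v))"
      by (rule frechet_derivative_at[symmetric])
    then show ?thesis by (simp add: d_zbar_def)
  qed
  have "((\<lambda>w. (complex_of_real (frechet_derivative f (at w) (axis j 1))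
       + \<i> * of_real (frechet_derivative f (at w) (axis j \<i>))) / 2) has_derivative
       (\<lambda>a. (of_real (hess f z a (axis j 1)) + \<i> * of_real (hess f z a (axis j \<i>))) / 2)) (at z)"
    by (auto intro!: derivative_eq_intros has_derivative_hess[OF f])
  then have "(d_zbar j (\<lambda>w. complex_of_real (f w)) has_derivative
       (\<lambda>a. (of_real (hess f z a (axis j 1)) + \<i> * of_real (hess f z a (axis j \<i>))) / 2)) (at z)"
    by (rule has_derivative_transform_within_open[OF _ f(2,3)]) (simp add: inner)
  from frechet_derivative_at[OF this, symmetric] show ?thesis
    by (simp add: d_z_def field_simps)
qed

text \<open>The vectors \<open>axis i 1\<close> and \<open>axis i \<i>\<close> form a real basis of
  the complex coordinate space.\<close>

lemma linear_axis_expansion: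
  fixes L :: "complex^'n \<Rightarrow> real"
  assumes "linear L"
  shows "L v = (\<Sum>i\<in>UNIV. Re (v $ i) * L (axis i 1) + Im (v $ i) * L (axis i \<i>))"
proof -
  have "v = (\<Sum>i\<in>UNIV. Re (v $ i) *\<^sub>R axis i 1 + Im (v $ i) *\<^sub>R axis i \<i>)"
    by (simp add: vec_eq_iff axis_def if_distrib[of "\<lambda>x. _ *\<^sub>R x"] sum.distrib complex_eq_iff
        cong: if_cong)
  then have "L v = L (\<Sum>i\<in>UNIV. Re (v $ i) *\<^sub>R axis i 1 + Im (v $ i) *\<^sub>R axis i \<i>)"
    by metis
  also have "\<dots> = (\<Sum>i\<in>UNIV. Re (v $ i) * L (axis i 1) + Im (v $ i) * L (axis i \<i>))"
    using assms by (simp add: linear_sum linear_add linear_scale)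
  finally show ?thesis .
qed

lemma hess_expansion:
  fixes f :: "complex^'n \<Rightarrow> real"
  assumes "smooth_on f U" "open U" "z \<in> U"
  shows "hess f z v w = (\<Sum>i\<in>UNIV. \<Sum>j\<in>UNIV.
     Re (v $ i) * (Re (w $ j) * hess f z (axis i 1) (axis j 1) + Im (w $ j) * hess f z (axis i 1) (axis j \<i>)) +
     Im (v $ i) * (Re (w $ j) * hess f z (axis i \<i>) (axis j 1) + Im (w $ j) * hess f z (axis i \<i>) (axis j \<i>)))"
  by (subst linear_axis_expansion[OF linear_hess_left[OF assms]],
      subst (1 2) linear_axis_expansion[OF linear_hess_right[OF assms]])
    (simp add: sum_distrib_left sum.distrib algebra_simps)

text \<open>With \<open>v\<close> read as a real tangent vector, the form is
  \<open>(\<partial>\<^sub>v - \<i> \<partial>\<^sub>w) (\<partial>\<^sub>v + \<i> \<partial>\<^sub>w) f / 4\<close> for \<open>w = \<i> *s v\<close>; the mixed terms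
  are imaginary, so the symmetry of the Hessian is not involved.\<close>

lemma Re_sesq_ddbar:
  fixes f :: "complex^'n \<Rightarrow> real"
  assumes f: "smooth_on f U" "open U" "z \<in> U"
  shows "Re (sesq (\<chi> i j. d_z i (d_zbar j (\<lambda>w. complex_of_real (f w))) z) v v) =
    (hess f z v v + hess f z (\<i> *s v) (\<i> *s v)) / 4"
  unfolding sesq_def Re_sum hess_expansion[OF f, of v] hess_expansion[OF f, of "\<i> *s v"]
    sum.distrib[symmetric] sum_divide_distrib
  by (intro sum.cong refl) (simp add: d_z_d_zbar_hess[OF f] algebra_simps add_divide_distrib diff_divide_distrib)

text \<open>Restricting to the real line through \<open>z\<close> in direction \<open>v\<close>
  reduces the claim to the second derivative test in one variable.\<close>

lemma hess_diff_nonpos_at_max: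
  assumes f: "smooth_on f U" and g: "smooth_on g U" and U: "open U" "z \<in> U"
    and max: "\<And>w. w \<in> U \<Longrightarrow> f w - g w \<le> f z - g z"
  shows "hess f z v v \<le> hess g z v v"
proof -
  have "continuous (at 0) (\<lambda>s::real. z + s *\<^sub>R v)" by (intro continuous_intros)
  then have "\<forall>\<^sub>F s in nhds (0::real). z + s *\<^sub>R v \<in> U"
    using U by (auto simp: continuous_at_open eventually_nhds)
  then obtain e where e: "0 < e" "\<And>s::real. \<bar>s\<bar> < e \<Longrightarrow> z + s *\<^sub>R v \<in> U"
    by (auto simp: eventually_nhds_metric dist_real_def)
  have line: "((\<lambda>s. z + s *\<^sub>R v) has_derivative (\<lambda>s. s *\<^sub>R v)) (at s)" for s :: real
    by (auto intro!: derivative_eq_intros)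
  have 1: "((\<lambda>s. k (z + s *\<^sub>R v)) has_real_derivative frechet_derivative k (at (z + s *\<^sub>R v)) v) (at s)"
    if "smooth_on k U" "\<bar>s\<bar> < e" for k s
  proof -
    have d: "k differentiable at (z + s *\<^sub>R v)"
      using smooth_on_derivatives(1)[OF that(1) U(1) e(2)[OF that(2)]] .
    have "((\<lambda>s. k (z + s *\<^sub>R v)) has_derivative (\<lambda>r. frechet_derivative k (at (z + s *\<^sub>R v)) (r *\<^sub>R v))) (at s)"
      using has_derivative_compose[OF line, of k] d by (simp add: frechet_derivative_works)
    then show ?thesis
      by (simp add: linear_scale[OF linear_frechet_derivative[OF d]] has_field_derivative_def mult.commute[of _ "frechet_derivative _ _ _"])
  qed
  have 2: "((\<lambda>s. frechet_derivative k (at (z + s *\<^sub>R v)) v) has_real_derivative hess k z v v) (at 0)"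
    if "smooth_on k U" for k
  proof -
    have "((\<lambda>w. frechet_derivative k (at w) v) has_derivative (\<lambda>a. hess k z a v)) (at (z + 0 *\<^sub>R v))"
      using has_derivative_hess[OF that U] by simp
    from has_derivative_compose[OF line this]
    have "((\<lambda>s. frechet_derivative k (at (z + s *\<^sub>R v)) v) has_derivative (\<lambda>r. hess k z (r *\<^sub>R v) v)) (at 0)" .
    then show ?thesis
      by (simp add: linear_scale[OF linear_hess_left[OF that U]] has_field_derivative_def mult.commute[of _ "hess _ _ _ _"])
  qed
  have "hess f z v v - hess g z v v \<le> 0"
    by (rule second_derivative_nonpos_at_max[OF e(1) _
          DERIV_diff[OF 1[OF f] 1[OF g]] DERIV_diff[OF 2[OF f] 2[OF g]]])
      (auto intro!: max e(2))
  then show ?thesis by simp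
qed

section \<open>Comparison of the operator at a spatial maximum\<close>

lemma sesq_add: "sesq (G + H) v w = sesq G v w + sesq H v w"
  by (simp add: sesq_def algebra_simps sum.distrib)

text \<open>In a chart, the real Hessian inequality is applied in the two directions
  \<open>v\<close> and \<open>\<i> *s v\<close>, whose sum is the complex Hessian up to a
  factor.\<close>

lemma ddbar_le_at_max:
  assumes A: "complex_atlas A" "c \<in> A" "p \<in> cdom c"
    and f: "smooth_fun A f" and g: "smooth_fun A g"
    and max: "\<And>q. f q - g q \<le> f p - g p"
  shows "Re (sesq (ddbar f c p) v v) \<le> Re (sesq (ddbar g c p) v v)"
proof -
  let ?U = "cimg c" and ?z = "cmap c p"
  have U: "open ?U" "?z \<in> ?U" and p: "cinv c ?z = p"
    using A by (auto simp: complex_atlas_def cimg_def homeomorphism_def)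
  have s: "smooth_on (\<lambda>z. f (cinv c z)) ?U" "smooth_on (\<lambda>z. g (cinv c z)) ?U"
    using f g A(2) by (auto simp: smooth_fun_def comp_def)
  have "hess (\<lambda>z. f (cinv c z)) ?z a a \<le> hess (\<lambda>z. g (cinv c z)) ?z a a" for a
    by (rule hess_diff_nonpos_at_max[OF s U]) (simp add: p max)
  from this[of v] this[of "\<i> *s v"] show ?thesis
    by (simp add: ddbar_def Re_sesq_ddbar[OF s(1) U] Re_sesq_ddbar[OF s(2) U])
qed

lemma complex_atlas_chart_at:
  assumes "complex_atlas A"
  obtains c where "c \<in> A" "p \<in> cdom c"
proof -
  have "p \<in> (\<Union>c\<in>A. cdom c)" using assms by (simp add: complex_atlas_def)
  then show ?thesis using that by blast
qed

lemma Q_op_le_at_max: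
  assumes A: "complex_atlas A"
    and W: "hermitian_metric A W"
    and f: "f \<in> admissible_potentials A X" and g: "g \<in> admissible_potentials A X"
    and max: "\<And>q. f q - g q \<le> f p - g p"
  shows "Q_op A X W F f p \<le> Q_op A X W F g p"
proof -
  \<comment> \<open>This is the very chart that \<open>form_trace\<close> chooses at
    \<open>p\<close>, so both traces unfold in the same coordinates.\<close>
  define c where "c = (SOME c. c \<in> A \<and> p \<in> cdom c)"
  have "\<exists>c. c \<in> A \<and> p \<in> cdom c"
    using complex_atlas_chart_at[OF A] by metis
  then have c: "c \<in> A" "p \<in> cdom c"
    unfolding c_def by (metis (mono_tags, lifting) someI_ex)+
  have pos: "positive_hermitian (deformed_form X f c p)" "positive_hermitian (deformed_form X g c p)"
    "positive_hermitian (W c p)"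
    using f g W c by (auto simp: admissible_potentials_def hermitian_metric_def positive_form_def)
  have "Re (sesq (deformed_form X f c p) v v) \<le> Re (sesq (deformed_form X g c p) v v)" for v
    using ddbar_le_at_max[OF A c, of f g] max f g
    by (simp add: deformed_form_def sesq_add admissible_potentials_def)
  then have "form_trace A (deformed_form X g) W p \<le> form_trace A (deformed_form X f) W p"
    unfolding form_trace_def Let_def c_def[symmetric]
    by (intro trace_matrix_inv_antimono pos)
  \<comment> \<open>Positivity of the smaller trace puts both arguments where \<open>ln\<close> is
    monotone.\<close>
  moreover have "0 < form_trace A (deformed_form X g) W p"
    unfolding form_trace_def Let_def c_def[symmetric]
    by (intro trace_matrix_inv_pos pos)
  ultimately show ?thesis
    by (simp add: Q_op_def)
qed

section \<open>The maximum principle on space-time\<close>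

lemma smooth_fun_time_continuous:
  assumes A: "complex_atlas A" and u: "smooth_fun_time A T u"
  shows "continuous_on (UNIV \<times> {0..T}) (\<lambda>(p, t). u t p)"
  unfolding continuous_on_eq_continuous_within
proof clarify
  fix p t
  assume t: "t \<in> {0..T}"
  obtain c where c: "c \<in> A" "p \<in> cdom c"
    using complex_atlas_chart_at[OF A] .
  let ?D = "cdom c \<times> {0..T}"
  have dom: "open (cdom c)" and hom: "homeomorphism (cdom c) (cimg c) (cmap c) (cinv c)"
    using A c(1) by (auto simp: complex_atlas_def)
  have "smooth_on (\<lambda>(z, t). u t (cinv c z)) (cimg c \<times> {0..T})"
    using u c(1) by (simp add: smooth_fun_time_def)
  then have "Ck_on 0 (\<lambda>(z, t). u t (cinv c z)) (cimg c \<times> {0..T})"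
    unfolding smooth_on_def by blast
  then have "continuous_on (cimg c \<times> {0..T}) (\<lambda>(z, t). u t (cinv c z))" by simp
  moreover have "continuous_on ?D (\<lambda>(p, t). (cmap c p, t))"
    unfolding split_def
    by (intro continuous_intros continuous_on_compose2[OF homeomorphism_cont1[OF hom]]) auto
  ultimately have "continuous_on ?D (\<lambda>x. (\<lambda>(z, t). u t (cinv c z)) ((\<lambda>(p, t). (cmap c p, t)) x))"
    by (rule continuous_on_compose2) (auto simp: cimg_def)
  then have "continuous_on ?D (\<lambda>(p, t). u t p)"
    by (rule continuous_on_eq) (use hom in \<open>auto simp: homeomorphism_def\<close>)
  then have "continuous (at (p, t) within ?D) (\<lambda>(p, t). u t p)"
    using c(2) t by (simp add: continuous_on_eq_continuous_within)
  \<comment> \<open>\<open>cdom c\<close> is open, so near \<open>(p, t)\<close> the chart cylinder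
    and the whole space-time coincide.\<close>
  also have "at (p, t) within ?D = at (p, t) within UNIV \<times> {0..T}"
    by (rule at_within_nhd[of _ "cdom c \<times> UNIV"]) (use c dom in \<open>auto intro: open_Times\<close>)
  finally show "continuous (at (p, t) within UNIV \<times> {0..T}) (\<lambda>(p, t). u t p)" .
qed

lemma flow_comparison:
  fixes A :: "('a::t2_space, 'n::finite) chart set"
  assumes A: "complex_atlas A" "compact (UNIV :: 'a set)" and W: "hermitian_metric A W"
    and f: "admissible_solution A X W F T f" and g: "admissible_solution A X W F T g"
    and init: "\<And>q. f 0 q - g 0 q \<le> C"
    and t: "t \<in> {0..T}"
  shows "f t p - g t p \<le> C"
proof (rule field_le_epsilon)
  fix e :: real
  assume "0 < e"
  \<comment> \<open>This slope keeps the penalty \<open>d * t\<close> below \<open>e\<close>; the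
    added 1 keeps the denominator positive even for \<open>T = 0\<close>.\<close>
  define d where "d = e / (T + 1)"
  have T: "0 \<le> T" using t by simp
  have "e * t \<le> e * (T + 1)"
    using \<open>0 < e\<close> t by (intro mult_left_mono) auto
  then have d: "0 < d" "d * t \<le> e"
    using \<open>0 < e\<close> T by (auto simp: d_def field_simps)
  define w where "w s q = f s q - g s q - d * s" for s q
  have "continuous_on (UNIV \<times> {0..T}) (\<lambda>x. (\<lambda>(q, s). f s q) x - (\<lambda>(q, s). g s q) x - d * snd x)"
    using f g by (intro continuous_intros smooth_fun_time_continuous[OF A(1)])
      (auto simp: admissible_solution_def)
  moreover have "compact ((UNIV :: 'a set) \<times> {0..T})"
    by (intro compact_Times A compact_Icc)
  ultimately obtain x where x: "x \<in> UNIV \<times> {0..T}"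
      "\<forall>y\<in>UNIV \<times> {0..T}. (\<lambda>(q, s). f s q) y - (\<lambda>(q, s). g s q) y - d * snd y
        \<le> (\<lambda>(q, s). f s q) x - (\<lambda>(q, s). g s q) x - d * snd x"
    using continuous_attains_sup[of "(UNIV :: 'a set) \<times> {0..T}"] t by blast
  obtain p\<^sub>0 t\<^sub>0 where xeq: "x = (p\<^sub>0, t\<^sub>0)" by fastforce
  have t\<^sub>0: "t\<^sub>0 \<in> {0..T}" and max: "\<And>s q. s \<in> {0..T} \<Longrightarrow> w s q \<le> w t\<^sub>0 p\<^sub>0"
    using x by (auto simp: xeq w_def)
  have "t\<^sub>0 = 0"
  proof (rule ccontr)
    assume "t\<^sub>0 \<noteq> 0"
    have "Q_op A X W F (f t\<^sub>0) p\<^sub>0 \<le> Q_op A X W F (g t\<^sub>0) p\<^sub>0"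
      using f g t\<^sub>0 max[of t\<^sub>0]
      by (intro Q_op_le_at_max[OF A(1) W]) (auto simp: admissible_solution_def w_def)
    moreover have "((\<lambda>s. w s p\<^sub>0) has_real_derivative
        Q_op A X W F (f t\<^sub>0) p\<^sub>0 - Q_op A X W F (g t\<^sub>0) p\<^sub>0 - d) (at t\<^sub>0 within {0..T})"
      using f g t\<^sub>0 unfolding w_def admissible_solution_def
      by (auto intro!: derivative_eq_intros)
    \<comment> \<open>The derivative is at most \<open>-d\<close>, so \<open>w\<close> is strictly
      larger slightly earlier. Only steps to the left are taken, which covers
      \<open>t\<^sub>0 = T\<close> as well.\<close>
    ultimately obtain r where r: "r > 0" "\<And>h. h > 0 \<Longrightarrow> t\<^sub>0 - h \<in> {0..T} \<Longrightarrow> h < r \<Longrightarrow> w t\<^sub>0 p\<^sub>0 < w (t\<^sub>0 - h) p\<^sub>0"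
      using has_real_derivative_neg_dec_left[of "\<lambda>s. w s p\<^sub>0"] \<open>0 < d\<close> by fastforce
    define h where "h = min r t\<^sub>0 / 2"
    have "h > 0" "h < r" "t\<^sub>0 - h \<in> {0..T}"
      using r(1) t\<^sub>0 \<open>t\<^sub>0 \<noteq> 0\<close> by (auto simp: h_def min_def)
    then show False
      using r(2)[of h] max[of "t\<^sub>0 - h" p\<^sub>0] by simp
  qed
  \<comment> \<open>At time 0 the penalty vanishes, so the maximum of \<open>w\<close> is a value of
    \<open>f 0 - g 0\<close>.\<close>
  then have "w t p \<le> C"
    using max[OF t, of p] init[of p\<^sub>0] by (simp add: w_def)
  then show "f t p - g t p \<le> C + e"
    using d(2) by (simp add: w_def)
qed

text \<open>On the reals, \<open>SUP\<close> and \<open>INF\<close> bound a function only if its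
  range is bounded; compactness supplies this.\<close>

lemma bounded_difference_at_time:
  fixes A :: "('a::t2_space, 'n::finite) chart set"
  assumes A: "complex_atlas A" "compact (UNIV :: 'a set)"
    and u: "smooth_fun_time A T u" and v: "smooth_fun_time A T v" and t: "t \<in> {0..T}"
  shows "bounded (range (\<lambda>p. u t p - v t p))"
proof -
  have *: "continuous_on UNIV (\<lambda>p. w t p)" if "smooth_fun_time A T w" for w
  proof -
    have "continuous_on UNIV (\<lambda>p. (\<lambda>(p, t). w t p) (p, t))"
      by (rule continuous_on_compose2[OF smooth_fun_time_continuous[OF A(1) that]])
        (use t in \<open>auto intro!: continuous_on_Pair continuous_on_id continuous_on_const\<close>)
    then show ?thesis by simp
  qed
  show ?thesis
    using A(2) by (intro compact_imp_bounded compact_continuous_image continuous_intros * u v)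
qed

theorem corollary3p2:
  fixes A :: "('a::t2_space, 'n::finite) chart set"
    and \<omega> X :: "('a, 'n) form11"
    and F \<phi>\<^sub>0 \<psi>\<^sub>0 :: "'a \<Rightarrow> real"
    and T :: real
    and \<phi> \<psi> :: "real \<Rightarrow> 'a \<Rightarrow> real"
  assumes "complex_atlas A"
    and "compact (UNIV :: 'a set)"
    and "connected (UNIV :: 'a set)"
    and "CARD('n) \<ge> 2"
    and "hermitian_metric A \<omega>"
    and "hermitian_metric A X"
    and "smooth_fun A F"
    and "0 < T"
    and "\<phi>\<^sub>0 \<in> admissible_potentials A X"
    and "\<psi>\<^sub>0 \<in> admissible_potentials A X"
    and "admissible_solution A X \<omega> F T \<phi>"
    and "\<phi> 0 = \<phi>\<^sub>0"
    and "admissible_solution A X \<omega> F T \<psi>"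
    and "\<psi> 0 = \<psi>\<^sub>0"
  shows "\<forall>t\<in>{0..T}.
           (SUP p. \<phi> t p - \<psi> t p) \<le> (SUP p. \<phi> 0 p - \<psi> 0 p) \<and>
           (INF p. \<phi> t p - \<psi> t p) \<ge> (INF p. \<phi> 0 p - \<psi> 0 p) \<and>
           osc (\<lambda>p. \<phi> t p - \<psi> t p) \<le> osc (\<lambda>p. \<phi> 0 p - \<psi> 0 p)"
proof
  fix t
  assume t: "t \<in> {0..T}"
  have "bounded (range (\<lambda>p. \<phi> 0 p - \<psi> 0 p))"
    using assms by (intro bounded_difference_at_time[of A T]) (auto simp: admissible_solution_def)
  then have bdd: "bdd_above (range (\<lambda>p. \<phi> 0 p - \<psi> 0 p))" "bdd_below (range (\<lambda>p. \<phi> 0 p - \<psi> 0 p))"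
    by (simp_all add: bounded_imp_bdd_above bounded_imp_bdd_below)
  have "\<phi> t p - \<psi> t p \<le> (SUP p. \<phi> 0 p - \<psi> 0 p)" for p
    by (rule flow_comparison[OF assms(1,2,5,11,13) cSUP_upper[OF _ bdd(1)] t]) simp
  then have sup: "(SUP p. \<phi> t p - \<psi> t p) \<le> (SUP p. \<phi> 0 p - \<psi> 0 p)"
    by (intro cSUP_least) auto
  \<comment> \<open>The lower bound is the upper bound with the two solutions exchanged.\<close>
  have "\<psi> 0 q - \<phi> 0 q \<le> - (INF p. \<phi> 0 p - \<psi> 0 p)" for q
    using cINF_lower[OF bdd(2), of q] by simp
  then have "\<psi> t p - \<phi> t p \<le> - (INF p. \<phi> 0 p - \<psi> 0 p)" for p
    by (rule flow_comparison[OF assms(1,2,5,13,11) _ t])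
  then have "(INF p. \<phi> 0 p - \<psi> 0 p) \<le> \<phi> t p - \<psi> t p" for p
    by (smt (verit))
  then have "(INF p. \<phi> t p - \<psi> t p) \<ge> (INF p. \<phi> 0 p - \<psi> 0 p)"
    by (intro cINF_greatest) auto
  with sup show "(SUP p. \<phi> t p - \<psi> t p) \<le> (SUP p. \<phi> 0 p - \<psi> 0 p) \<and>
           (INF p. \<phi> t p - \<psi> t p) \<ge> (INF p. \<phi> 0 p - \<psi> 0 p) \<and>
           osc (\<lambda>p. \<phi> t p - \<psi> t p) \<le> osc (\<lambda>p. \<phi> 0 p - \<psi> 0 p)"
    by (simp add: osc_def)
qed

end
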